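(* Let $R$ be a $\sigma$-Euclidean ring. Then $SL^\sigma(2,R)=E^\sigma(2,R)$.
   Context: Rings are unital. An involution on a ring $R$ is an additive map $\sigma:R\to R$ with $\sigma(xy)=\sigma(y)\sigma(x)$ and $\sigma(\sigma(x))=x$ for all $x,y$; write $R^+=\{r\in R\mid\sigma(r)=r\}$. A ring with involution $(R,\sigma)$ without zero divisors is $\sigma$-Euclidean if there exist a well-ordered set $W$ and a function $\Phi:R\to W$ such that for all $a,b\in R$ with $b\neq0$ and $a\sigma(b)\in R^+$ there exists $q\in R^+$ with $\Phi(a-bq)<\Phi(b)$. Define $\hat\sigma\begin{pmatrix}a&b\\c&d\end{pmatrix}=\begin{pmatrix}\sigma(d)&-\sigma(b)\\-\sigma(c)&\sigma(a)\end{pmatrix}$ on $\mathrm{Mat}(2,R)$ and $SL^\sigma(2,R)=\{M\in\mathrm{Mat}(2,R)\mid M\hat\sigma(M)=\hat\sigma(M)M=1\}$. $E^\sigma(2,R)$ is the subgroup of $SL^\sigma(2,R)$ generated by the matrices $\begin{pmatrix}1&\tau\\0&1\end{pmatrix}$, $\begin{pmatrix}u&0\\0&\sigma(u)^{-1}\end{pmatrix}$, $\begin{pmatrix}0&1\\-1&0\end{pmatrix}$ with $\tau\in R^+$ and $u\in R^\times$. *)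

theory Defs
  imports "HOL-Analysis.Cartesian_Space" "HOL-Algebra.Generated_Groups"
begin

definition ring_involution :: "('a::ring_1 \<Rightarrow> 'a) \<Rightarrow> bool" where
  "ring_involution \<sigma> \<longleftrightarrow>
     (\<forall>x y. \<sigma> (x + y) = \<sigma> x + \<sigma> y) \<and>
     (\<forall>x y. \<sigma> (x * y) = \<sigma> y * \<sigma> x) \<and>
     (\<forall>x. \<sigma> (\<sigma> x) = x)"

definition sym_elems :: "('a::ring_1 \<Rightarrow> 'a) \<Rightarrow> 'a set" where
  "sym_elems \<sigma> = {r. \<sigma> r = r}"

text \<open>HOL cannot quantify over all well-ordered sets inside a definition, so the type in which
  the well-ordered set \<open>W\<close> lives is a parameter. In a theorem that assumes \<open>sigma_euclidean\<close>, the
  type \<open>'w\<close> is universally quantified, which amounts to an unrestricted existential over \<open>W\<close> in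
  the hypothesis. The relation \<open>r\<close> is the reflexive order of \<open>W\<close>; its strict part is \<open>r - Id\<close>.
  The absence of zero divisors is the type class; it includes \<open>0 \<noteq> 1\<close>.\<close>

definition sigma_euclidean :: "'w itself \<Rightarrow> ('a::ring_1_no_zero_divisors \<Rightarrow> 'a) \<Rightarrow> bool" where
  "sigma_euclidean TYPE('w) \<sigma> \<longleftrightarrow> ring_involution \<sigma> \<and>
     (\<exists>(W :: 'w set) r (\<Phi> :: 'a \<Rightarrow> 'w). well_order_on W r \<and> (\<forall>x. \<Phi> x \<in> W) \<and>
        (\<forall>a b. b \<noteq> 0 \<and> a * \<sigma> b \<in> sym_elems \<sigma> \<longrightarrow>
           (\<exists>q \<in> sym_elems \<sigma>. (\<Phi> (a - b * q), \<Phi> b) \<in> r - Id)))"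

definition mat2 :: "'a::zero \<Rightarrow> 'a \<Rightarrow> 'a \<Rightarrow> 'a \<Rightarrow> 'a^2^2" where
  "mat2 a b c d = vector [vector [a, b], vector [c, d]]"

definition hat :: "('a::ring_1 \<Rightarrow> 'a) \<Rightarrow> 'a^2^2 \<Rightarrow> 'a^2^2" where
  "hat \<sigma> M = mat2 (\<sigma> (M$2$2)) (- \<sigma> (M$1$2)) (- \<sigma> (M$2$1)) (\<sigma> (M$1$1))"

definition SL_sigma :: "('a::ring_1 \<Rightarrow> 'a) \<Rightarrow> ('a^2^2) set" where
  "SL_sigma \<sigma> = {M. M ** hat \<sigma> M = mat 1 \<and> hat \<sigma> M ** M = mat 1}"

definition SL_sigma_group :: "('a::ring_1 \<Rightarrow> 'a) \<Rightarrow> ('a^2^2) monoid" where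
  "SL_sigma_group \<sigma> = \<lparr>carrier = SL_sigma \<sigma>, mult = (**), one = mat 1\<rparr>"

definition ring_units :: "'a::ring_1 set" where
  "ring_units = {u. \<exists>v. u * v = 1 \<and> v * u = 1}"

text \<open>The class \<^class>\<open>ring_1\<close> has no inverse operation: \<open>w\<close> below is the unique two-sided inverse
  \<open>\<sigma>(u)\<^sup>-\<^sup>1\<close>.\<close>

definition elementary_gens :: "('a::ring_1 \<Rightarrow> 'a) \<Rightarrow> ('a^2^2) set" where
  "elementary_gens \<sigma> =
     {mat2 1 \<tau> 0 1 | \<tau>. \<tau> \<in> sym_elems \<sigma>} \<union>
     {mat2 u 0 0 w | u w. u \<in> ring_units \<and> \<sigma> u * w = 1 \<and> w * \<sigma> u = 1} \<union>
     {mat2 0 1 (- 1) 0}"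

definition E_sigma :: "('a::ring_1 \<Rightarrow> 'a) \<Rightarrow> ('a^2^2) set" where
  "E_sigma \<sigma> = generate (SL_sigma_group \<sigma>) (elementary_gens \<sigma>)"

text \<open>The lemmas \<open>group_SL_sigma\<close> and \<open>elementary_gens_subset\<close> below show that \<^const>\<open>generate\<close> is applied to a subset of a group, so that
  \<^const>\<open>E_sigma\<close> is the generated subgroup.\<close>

lemma mat2_nth [simp]:
  "mat2 a b c d $ 1 $ 1 = a" "mat2 a b c d $ 1 $ 2 = b"
  "mat2 a b c d $ 2 $ 1 = c" "mat2 a b c d $ 2 $ 2 = d"
  by (simp_all add: mat2_def)

lemma mat_eq2: "(M :: 'a^2^2) = N \<longleftrightarrow>
    M$1$1 = N$1$1 \<and> M$1$2 = N$1$2 \<and> M$2$1 = N$2$1 \<and> M$2$2 = N$2$2"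
  by (auto simp: vec_eq_iff forall_2)

lemma mult_nth2: "((M :: 'a::ring_1^2^2) ** N) $ i $ j = M$i$1 * N$1$j + M$i$2 * N$2$j"
  by (simp add: matrix_matrix_mult_def sum_2)

lemma ring_involution_simps:
  assumes "ring_involution \<sigma>"
  shows "\<sigma> (x + y) = \<sigma> x + \<sigma> y" "\<sigma> (x * y) = \<sigma> y * \<sigma> x" "\<sigma> (\<sigma> x) = x"
    "\<sigma> 0 = 0" "\<sigma> 1 = 1" "\<sigma> (- x) = - \<sigma> x"
proof -
  have add: "\<sigma> (x + y) = \<sigma> x + \<sigma> y" and mult: "\<sigma> (x * y) = \<sigma> y * \<sigma> x" and inv: "\<sigma> (\<sigma> x) = x"
    for x y using assms by (auto simp: ring_involution_def)
  show "\<sigma> (x + y) = \<sigma> x + \<sigma> y" "\<sigma> (x * y) = \<sigma> y * \<sigma> x" "\<sigma> (\<sigma> x) = x"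
    by (fact add mult inv)+
  show z: "\<sigma> 0 = 0" using add[of 0 0] by simp
  show "\<sigma> 1 = 1" using mult[of 1 "\<sigma> 1"] by (simp add: inv)
  show "\<sigma> (- x) = - \<sigma> x" using add[of x "- x"] z by (simp add: eq_neg_iff_add_eq_0 add.commute)
qed

lemma hat_mult:
  assumes "ring_involution \<sigma>"
  shows "hat \<sigma> (M ** N) = hat \<sigma> N ** hat \<sigma> M"
  by (simp add: mat_eq2 hat_def mult_nth2 ring_involution_simps[OF assms])

lemma hat_hat:
  assumes "ring_involution \<sigma>"
  shows "hat \<sigma> (hat \<sigma> M) = M"
  by (simp add: mat_eq2 hat_def ring_involution_simps[OF assms])

lemma hat_one:
  assumes "ring_involution \<sigma>"
  shows "hat \<sigma> (mat 1) = mat 1"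
  by (simp add: mat_eq2 hat_def mat_def ring_involution_simps[OF assms])

lemma SL_sigma_mult:
  assumes \<sigma>: "ring_involution \<sigma>" and "M \<in> SL_sigma \<sigma>" "N \<in> SL_sigma \<sigma>"
  shows "M ** N \<in> SL_sigma \<sigma>"
proof -
  have M: "M ** hat \<sigma> M = mat 1" "hat \<sigma> M ** M = mat 1"
    and N: "N ** hat \<sigma> N = mat 1" "hat \<sigma> N ** N = mat 1"
    using assms by (auto simp: SL_sigma_def)
  have "(M ** N) ** (hat \<sigma> N ** hat \<sigma> M) = M ** (N ** hat \<sigma> N) ** hat \<sigma> M"
    by (simp add: matrix_mul_assoc)
  moreover have "(hat \<sigma> N ** hat \<sigma> M) ** (M ** N) = hat \<sigma> N ** (hat \<sigma> M ** M) ** N"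
    by (simp add: matrix_mul_assoc)
  ultimately show ?thesis
    by (simp add: SL_sigma_def hat_mult[OF \<sigma>] M N)
qed

lemma group_SL_sigma:
  assumes \<sigma>: "ring_involution \<sigma>"
  shows "group (SL_sigma_group \<sigma>)"
proof (rule groupI)
  fix M assume "M \<in> carrier (SL_sigma_group \<sigma>)"
  then show "\<exists>N \<in> carrier (SL_sigma_group \<sigma>). N \<otimes>\<^bsub>SL_sigma_group \<sigma>\<^esub> M = \<one>\<^bsub>SL_sigma_group \<sigma>\<^esub>"
    by (intro bexI[of _ "hat \<sigma> M"]) (simp_all add: SL_sigma_group_def SL_sigma_def hat_hat[OF \<sigma>])
qed (simp_all add: SL_sigma_group_def SL_sigma_mult[OF \<sigma>] matrix_mul_assoc,
     simp add: SL_sigma_def hat_one[OF \<sigma>])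

lemma elementary_gens_subset:
  assumes \<sigma>: "ring_involution \<sigma>"
  shows "elementary_gens \<sigma> \<subseteq> carrier (SL_sigma_group \<sigma>)"
proof -
  have "\<sigma> w * u = 1" "u * \<sigma> w = 1" if "\<sigma> u * w = 1" "w * \<sigma> u = 1" for u w
    using that[THEN arg_cong[where f = \<sigma>]] by (simp_all add: ring_involution_simps[OF \<sigma>])
  then show ?thesis
    by (auto simp: elementary_gens_def SL_sigma_group_def SL_sigma_def mat_eq2 hat_def mult_nth2
        mat_def sym_elems_def ring_involution_simps[OF \<sigma>])
qed

end

theory Submission imports Defs begin

text \<open>Write \<open>M\<close> for a matrix of \<open>SL\<^sup>\<sigma>(2,R)\<close> with first row \<open>(a, b)\<close>, let \<open>w\<close> be the Weyl element
  \<open>(0 1; -1 0)\<close>, and \<open>t(q) = (1 q; 0 1)\<close>. Membership in the group forces \<open>a \<sigma>(b) \<in> R\<^sup>+\<close>, so if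
  \<open>b \<noteq> 0\<close> the Euclidean condition supplies \<open>q \<in> R\<^sup>+\<close> with \<open>\<Phi>(a - b q) < \<Phi>(b)\<close>. The matrix
  \<open>M w t(q)\<close> has first row \<open>(-b, a - b q)\<close> and lies in the elementary subgroup exactly when \<open>M\<close>
  does. Well-founded induction on \<open>\<Phi>(b)\<close> thus reduces the theorem to \<open>b = 0\<close>: a lower triangular
  \<open>M\<close> is, up to conjugation by \<open>w\<close>, a diagonal generator times some \<open>t(\<tau>)\<close> with \<open>\<tau> \<in> R\<^sup>+\<close>
  (lemma \<open>SL_sigma_lower_triangular_in_E_sigma\<close>).\<close>

lemma SL_sigma_entries:
  assumes \<sigma>: "ring_involution \<sigma>" and M: "M \<in> SL_sigma \<sigma>"
  shows "M$1$1 * \<sigma> (M$1$2) \<in> sym_elems \<sigma>"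
    and "\<sigma> (M$1$1) * M$2$1 \<in> sym_elems \<sigma>"
    and "M$1$1 * \<sigma> (M$2$2) - M$1$2 * \<sigma> (M$2$1) = 1"
    and "\<sigma> (M$2$2) * M$1$1 - \<sigma> (M$1$2) * M$2$1 = 1"
  using M
  by (auto simp: SL_sigma_def mat_eq2 hat_def mult_nth2 mat_def sym_elems_def
      ring_involution_simps[OF \<sigma>])

lemma E_sigma_subset_SL_sigma:
  assumes \<sigma>: "ring_involution \<sigma>"
  shows "E_sigma \<sigma> \<subseteq> SL_sigma \<sigma>"
  using group.generate_incl[OF group_SL_sigma[OF \<sigma>] elementary_gens_subset[OF \<sigma>]]
  by (simp add: E_sigma_def SL_sigma_group_def)

lemma E_sigma_mult:
  assumes "M \<in> E_sigma \<sigma>" "N \<in> E_sigma \<sigma>"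
  shows "M ** N \<in> E_sigma \<sigma>"
  using generate.eng[OF assms[unfolded E_sigma_def]]
  by (simp add: E_sigma_def SL_sigma_group_def)

lemma transvection_in_E_sigma:
  assumes "q \<in> sym_elems \<sigma>"
  shows "mat2 1 q 0 1 \<in> E_sigma \<sigma>"
  unfolding E_sigma_def by (rule generate.incl) (use assms in \<open>auto simp: elementary_gens_def\<close>)

lemma diagonal_in_E_sigma:
  assumes \<sigma>: "ring_involution \<sigma>" and "\<sigma> u * v = 1" "v * \<sigma> u = 1"
  shows "mat2 u 0 0 v \<in> E_sigma \<sigma>"
proof -
  have "u * \<sigma> v = 1" "\<sigma> v * u = 1"
    using assms(2,3)[THEN arg_cong[where f = \<sigma>]] by (simp_all add: ring_involution_simps[OF \<sigma>])
  then have "u \<in> ring_units"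
    by (auto simp: ring_units_def)
  then show ?thesis
    unfolding E_sigma_def
    by (intro generate.incl) (use assms in \<open>auto simp: elementary_gens_def\<close>)
qed

lemma weyl_in_E_sigma: "mat2 0 1 (- 1) 0 \<in> E_sigma \<sigma>"
  unfolding E_sigma_def by (rule generate.incl) (simp add: elementary_gens_def)

lemma weyl_inverse_in_E_sigma:
  assumes \<sigma>: "ring_involution \<sigma>"
  shows "mat2 0 (- 1) 1 0 \<in> E_sigma \<sigma>"
proof -
  have "mat2 (- 1) 0 0 (- 1) \<in> E_sigma \<sigma>"
    by (rule diagonal_in_E_sigma[OF \<sigma>]) (simp_all add: ring_involution_simps[OF \<sigma>])
  moreover have "mat2 0 (- 1) 1 0 = mat2 (- 1) 0 0 (- 1) ** mat2 0 1 (- 1 :: 'a) 0"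
    by (simp add: mat_eq2 mult_nth2)
  ultimately show ?thesis
    using E_sigma_mult weyl_in_E_sigma by metis
qed

lemma SL_sigma_lower_triangular_in_E_sigma:
  assumes \<sigma>: "ring_involution \<sigma>" and M: "M \<in> SL_sigma \<sigma>" and b: "M$1$2 = 0"
  shows "M \<in> E_sigma \<sigma>"
proof -
  define a c d where "a = M$1$1" and "c = M$2$1" and "d = M$2$2"
  define \<tau> where "\<tau> = - (\<sigma> a * c)"
  have ad: "a * \<sigma> d = 1" "\<sigma> d * a = 1" and \<tau>: "\<tau> \<in> sym_elems \<sigma>"
    using SL_sigma_entries[OF \<sigma> M] b
    by (simp_all add: a_def c_def d_def \<tau>_def sym_elems_def ring_involution_simps[OF \<sigma>])
  have da: "d * \<sigma> a = 1"
    using arg_cong[OF ad(1), of \<sigma>] by (simp add: ring_involution_simps[OF \<sigma>])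
  let ?w = "mat2 0 1 (- 1) 0 :: 'a^2^2" and ?w' = "mat2 0 (- 1) 1 0 :: 'a^2^2"
  have "d * \<tau> = - c"
    by (simp add: \<tau>_def da flip: mult.assoc)
  then have "M = ?w ** (mat2 d 0 0 a ** mat2 1 \<tau> 0 1) ** ?w'"
    using b by (simp add: mat_eq2 mult_nth2 a_def c_def d_def)
  moreover have "mat2 d 0 0 a \<in> E_sigma \<sigma>"
    by (rule diagonal_in_E_sigma[OF \<sigma> ad(2,1)])
  ultimately show ?thesis
    by (simp add: E_sigma_mult transvection_in_E_sigma[OF \<tau>] weyl_in_E_sigma
        weyl_inverse_in_E_sigma[OF \<sigma>])
qed

lemma in_E_sigma_if_euclidean_step_in_E_sigma:
  assumes \<sigma>: "ring_involution \<sigma>" and q: "q \<in> sym_elems \<sigma>"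
    and step: "M ** mat2 0 1 (- 1) 0 ** mat2 1 q 0 1 \<in> E_sigma \<sigma>"
  shows "M \<in> E_sigma \<sigma>"
proof -
  have "- q \<in> sym_elems \<sigma>"
    using q by (simp add: sym_elems_def ring_involution_simps[OF \<sigma>])
  note inv = transvection_in_E_sigma[OF this] weyl_inverse_in_E_sigma[OF \<sigma>]
  have "M = (M ** mat2 0 1 (- 1) 0 ** mat2 1 q 0 1) ** mat2 1 (- q) 0 1 ** mat2 0 (- 1) 1 0"
    by (simp add: mat_eq2 mult_nth2 algebra_simps)
  then show ?thesis
    using E_sigma_mult[OF E_sigma_mult[OF step inv(1)] inv(2)] by simp
qed

theorem corollary2p2:
  fixes \<sigma> :: "'a::ring_1_no_zero_divisors \<Rightarrow> 'a"
  assumes "sigma_euclidean TYPE('w) \<sigma>"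
  shows "SL_sigma \<sigma> = E_sigma \<sigma>"
proof
  have \<sigma>: "ring_involution \<sigma>"
    using assms by (simp add: sigma_euclidean_def)
  show "E_sigma \<sigma> \<subseteq> SL_sigma \<sigma>"
    by (rule E_sigma_subset_SL_sigma[OF \<sigma>])
  obtain W :: "'w set" and r and \<Phi> :: "'a \<Rightarrow> 'w" where W: "well_order_on W r"
    and div: "\<And>a b. b \<noteq> 0 \<Longrightarrow> a * \<sigma> b \<in> sym_elems \<sigma> \<Longrightarrow>
           \<exists>q \<in> sym_elems \<sigma>. (\<Phi> (a - b * q), \<Phi> b) \<in> r - Id"
    using assms unfolding sigma_euclidean_def by blast
  have "wf (inv_image (r - Id) (\<lambda>M :: 'a^2^2. \<Phi> (M$1$2)))"
    using W by (intro wf_inv_image) (simp add: well_order_on_def)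
  then have "M \<in> SL_sigma \<sigma> \<longrightarrow> M \<in> E_sigma \<sigma>" for M
  proof (induction M rule: wf_induct_rule)
    case (less M)
    show ?case
    proof (rule impI, cases "M$1$2 = 0")
      case True
      assume "M \<in> SL_sigma \<sigma>"
      then show "M \<in> E_sigma \<sigma>"
        using SL_sigma_lower_triangular_in_E_sigma[OF \<sigma>] True by blast
    next
      case False
      assume M: "M \<in> SL_sigma \<sigma>"
      obtain q where q: "q \<in> sym_elems \<sigma>"
        and dec: "(\<Phi> (M$1$1 - M$1$2 * q), \<Phi> (M$1$2)) \<in> r - Id"
        using div[OF False SL_sigma_entries(1)[OF \<sigma> M]] by blast
      let ?N = "M ** mat2 0 1 (- 1) 0 ** mat2 1 q 0 1"
      have "?N$1$2 = M$1$1 - M$1$2 * q"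
        by (simp add: mult_nth2)
      moreover have "?N \<in> SL_sigma \<sigma>"
        using M weyl_in_E_sigma transvection_in_E_sigma[OF q] E_sigma_subset_SL_sigma[OF \<sigma>]
        by (intro SL_sigma_mult[OF \<sigma>]) auto
      ultimately have "?N \<in> E_sigma \<sigma>"
        using less.IH[of ?N] dec by simp
      then show "M \<in> E_sigma \<sigma>"
        by (rule in_E_sigma_if_euclidean_step_in_E_sigma[OF \<sigma> q])
    qed
  qed
  then show "SL_sigma \<sigma> \<subseteq> E_sigma \<sigma>"
    by blast
qed

end
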